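(* Let $A$ be a finite commutative ring with identity, $\sigma$ a ring automorphism of $A$, $a\in U(A)$, and $\mathcal{C}=(g(X))^{a}_{n,\sigma}$ a principal $\sigma$-constacyclic code generated by some monic $g(X)=\sum_{i=0}^{n-k}g_iX^i\in A[X;\sigma]$ of degree $n-k$ with $g_0\in U(A)$. Let $h(X)=\sum_{i=0}^k h_iX^i\in A[X;\sigma]$ be such that $g(X)h(X)=X^n-\sigma^{-k}(a)$ (such $h$ exists). Then a parity-check matrix $H_*\in M_{n-k,n}(A)$ of $\mathcal{C}$ is given by $$\left( \begin{array}{ccccccccc} h_{k} & \sigma(h_{k-1}) & \sigma^2(h_{k-2})& \dots & \sigma^k(h_0) & 0 & 0 & \dots & 0\\ 0 & \sigma(h_{k}) & \sigma^2(h_{k-1}) & \dots & \sigma^k(h_1) & \sigma^{k+1}(h_0) & 0 & \dots & 0\\ \dots & \dots & \dots & \dots & \dots & \dots & \dots & \dots & \dots \\ 0 & 0 & 0 & \dots & \dots & \sigma^{n-k-1}(h_k) & \dots & \dots & \sigma^{n-1}(h_0) \end{array} \right),$$ i.e. for $0\le t\le n-k-1$, row $t$ consists of $t$ zeros, followed by $\sigma^t(h_k),\sigma^{t+1}(h_{k-1}),\dots,\sigma^{t+k}(h_0)$, followed by zeros.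
   Context: $U(A)$ is the group of units of $A$. $A[X;\sigma]$ is the skew-polynomial ring of elements $\sum a_iX^i$ with multiplication determined by $Xa=\sigma(a)X$; $(p)_l$ is the left ideal generated by $p$. For $a\in U(A)$ and $g$ a right divisor of $X^n-a$, the principal $\sigma$-constacyclic code $(g(X))_{n,\sigma}^a$ is the set of $(d_0,\dots,d_{n-1})\in A^n$ with $\sum_{i=0}^{n-1}d_iX^i+(X^n-a)_l\in(g)_l/(X^n-a)_l$; for $g$ monic of degree $n-k$ it is $A$-free of rank $k$. The dual is $\mathcal{C}^\perp=\{y\in A^n:\sum_i x_iy_i=0\text{ for all }x\in\mathcal{C}\}$. A matrix $H\in M_{n,t}(A)$, $t\le n$, is a control matrix of $\mathcal{C}$ if $\mathcal{C}=\{x\in A^n:xH=0\}$. A generating matrix of a free submodule of $A^n$ is a matrix whose rows form a basis of it. For an $A$-free code $\mathcal{C}$ of length $n$ and rank $k$, a matrix $H_*\in M_{n-k,n}(A)$ is a parity-check matrix of $\mathcal{C}$ if $H_*^T$ is a control matrix of $\mathcal{C}$ and $H_*$ is a generating matrix of $\mathcal{C}^\perp$. *)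

theory Defs
  imports Jordan_Normal_Form.VS_Connect "HOL-Algebra.Ideal"
begin

section \<open>Skew polynomials\<close>

text \<open>
  A polynomial \<open>p :: 'a poly\<close> is read as the skew polynomial \<open>\<Sum>i. p\<^sub>i X\<^sup>i\<close>, coefficients on the
  left. Only the multiplication differs from that of \<^typ>\<open>'a poly\<close>: since \<open>X a = \<sigma>(a) X\<close>, one has
  \<open>(a X\<^sup>i) (b X\<^sup>j) = a \<sigma>\<^sup>i(b) X\<^sup>i\<^sup>+\<^sup>j\<close>.
\<close>

definition skew_mult :: "('a::comm_ring_1 \<Rightarrow> 'a) \<Rightarrow> 'a poly \<Rightarrow> 'a poly \<Rightarrow> 'a poly" where
  "skew_mult \<sigma> p q =
     (\<Sum>i\<le>degree p. \<Sum>j\<le>degree q. monom (coeff p i * (\<sigma> ^^ i) (coeff q j)) (i + j))"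

definition skew_poly_ring :: "('a::comm_ring_1 \<Rightarrow> 'a) \<Rightarrow> 'a poly ring" where
  "skew_poly_ring \<sigma> = \<lparr>carrier = UNIV, mult = skew_mult \<sigma>, one = 1, zero = 0, add = (+)\<rparr>"

definition skew_right_divisor :: "('a::comm_ring_1 \<Rightarrow> 'a) \<Rightarrow> 'a poly \<Rightarrow> 'a poly \<Rightarrow> bool" where
  "skew_right_divisor \<sigma> g f \<longleftrightarrow> (\<exists>q. f = q \<otimes>\<^bsub>skew_poly_ring \<sigma>\<^esub> g)"

lemma comm_ring_hom_funpow:
  fixes \<sigma> :: "'a::comm_ring_1 \<Rightarrow> 'a"
  assumes "comm_ring_hom \<sigma>"
  shows "comm_ring_hom (\<sigma> ^^ i)"
proof -
  interpret comm_ring_hom \<sigma> by fact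
  have "(\<sigma> ^^ i) 0 = 0" "(\<sigma> ^^ i) 1 = 1" "(\<sigma> ^^ i) (x + y) = (\<sigma> ^^ i) x + (\<sigma> ^^ i) y"
    "(\<sigma> ^^ i) (x * y) = (\<sigma> ^^ i) x * (\<sigma> ^^ i) y" for x y
    by (induction i) (simp_all add: hom_add hom_mult)
  then show ?thesis by unfold_locales
qed

lemma coeff_skew_mult:
  fixes \<sigma> :: "'a::comm_ring_1 \<Rightarrow> 'a"
  assumes "comm_ring_hom \<sigma>"
  shows "coeff (skew_mult \<sigma> p q) m = (\<Sum>i\<le>m. coeff p i * (\<sigma> ^^ i) (coeff q (m - i)))"
proof -
  let ?c = "\<lambda>i j. coeff p i * (\<sigma> ^^ i) (coeff q j)"
  have zero: "(\<sigma> ^^ i) 0 = 0" for i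
  proof -
    interpret comm_ring_hom "\<sigma> ^^ i" by (rule comm_ring_hom_funpow[OF assms])
    show ?thesis by simp
  qed
  have inner: "(\<Sum>j\<le>degree q. coeff (monom (?c i j) (i + j)) m) =
      (if i \<le> m then ?c i (m - i) else 0)" for i
  proof -
    have "(\<Sum>j\<le>degree q. coeff (monom (?c i j) (i + j)) m) =
        (\<Sum>j\<le>degree q. if j = m - i then (if i \<le> m then ?c i (m - i) else 0) else 0)"
      by (rule sum.cong) auto
    also have "\<dots> = (if i \<le> m then ?c i (m - i) else 0)"
      by (auto simp: zero coeff_eq_0 not_le)
    finally show ?thesis .
  qed
  have "coeff (skew_mult \<sigma> p q) m = (\<Sum>i\<le>degree p. if i \<le> m then ?c i (m - i) else 0)"
    by (simp only: skew_mult_def coeff_sum inner)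
  also have "\<dots> = (\<Sum>i \<in> {..degree p} \<inter> {..m}. ?c i (m - i))"
    by (rule sum.mono_neutral_cong_right) auto
  also have "\<dots> = (\<Sum>i\<le>m. ?c i (m - i))"
    by (rule sum.mono_neutral_left) (auto intro!: le_degree)
  finally show ?thesis .
qed

lemma skew_mult_add_left:
  fixes \<sigma> :: "'a::comm_ring_1 \<Rightarrow> 'a"
  assumes "comm_ring_hom \<sigma>"
  shows "skew_mult \<sigma> (p + q) r = skew_mult \<sigma> p r + skew_mult \<sigma> q r"
  by (rule poly_eqI) (simp add: coeff_skew_mult[OF assms] distrib_right sum.distrib)

lemma skew_mult_add_right:
  fixes \<sigma> :: "'a::comm_ring_1 \<Rightarrow> 'a"
  assumes "comm_ring_hom \<sigma>"
  shows "skew_mult \<sigma> r (p + q) = skew_mult \<sigma> r p + skew_mult \<sigma> r q"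
proof -
  have "(\<sigma> ^^ i) (x + y) = (\<sigma> ^^ i) x + (\<sigma> ^^ i) y" for i x y
  proof -
    interpret comm_ring_hom "\<sigma> ^^ i" by (rule comm_ring_hom_funpow[OF assms])
    show ?thesis by (simp add: hom_add)
  qed
  then show ?thesis
    by (intro poly_eqI) (simp add: coeff_skew_mult[OF assms] distrib_left sum.distrib)
qed

lemma skew_mult_monom:
  fixes \<sigma> :: "'a::comm_ring_1 \<Rightarrow> 'a"
  assumes "comm_ring_hom \<sigma>"
  shows "skew_mult \<sigma> (monom a i) (monom b j) = monom (a * (\<sigma> ^^ i) b) (i + j)"
proof (rule poly_eqI)
  fix m
  have zero: "(\<sigma> ^^ i) 0 = 0"
  proof -
    interpret comm_ring_hom "\<sigma> ^^ i" by (rule comm_ring_hom_funpow[OF assms])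
    show ?thesis by simp
  qed
  have "coeff (skew_mult \<sigma> (monom a i) (monom b j)) m =
      (\<Sum>l\<le>m. if l = i then a * (\<sigma> ^^ i) (coeff (monom b j) (m - i)) else 0)"
    unfolding coeff_skew_mult[OF assms] by (rule sum.cong) auto
  also have "\<dots> = coeff (monom (a * (\<sigma> ^^ i) b) (i + j)) m"
    by (auto simp: zero)
  finally show "coeff (skew_mult \<sigma> (monom a i) (monom b j)) m =
      coeff (monom (a * (\<sigma> ^^ i) b) (i + j)) m" .
qed

text \<open>The defining relation \<open>X a = \<sigma>(a) X\<close>, and the ring laws.\<close>

lemma skew_mult_X_const:
  fixes \<sigma> :: "'a::comm_ring_1 \<Rightarrow> 'a"
  assumes "comm_ring_hom \<sigma>"
  shows "skew_mult \<sigma> (monom 1 1) [:a:] = skew_mult \<sigma> [:\<sigma> a:] (monom 1 1)"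
  using skew_mult_monom[OF assms, of 1 1 a 0] skew_mult_monom[OF assms, of "\<sigma> a" 0 1 1]
  by (simp add: monom_0)

lemma ring_skew_poly_ring:
  fixes \<sigma> :: "'a::comm_ring_1 \<Rightarrow> 'a"
  assumes "comm_ring_hom \<sigma>"
  shows "ring (skew_poly_ring \<sigma>)"
proof -
  note add = skew_mult_add_left[OF assms] skew_mult_add_right[OF assms]
  have monom_induct: "P p" if "P 0" "\<And>a i. P (monom a i)" "\<And>p q. P p \<Longrightarrow> P q \<Longrightarrow> P (p + q)"
    for P and p :: "'a poly"
  proof -
    have "P (\<Sum>i\<in>I. monom (coeff p i) i)" if "finite I" for I
      using that by induction (use \<open>P 0\<close> \<open>\<And>a i. P (monom a i)\<close>
          \<open>\<And>p q. P p \<Longrightarrow> P q \<Longrightarrow> P (p + q)\<close> in auto)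
    from this[of "{..degree p}"] show ?thesis by (simp add: poly_as_sum_of_monoms)
  qed
  have zero: "skew_mult \<sigma> 0 p = 0" "skew_mult \<sigma> p 0 = 0" for p
    using add(1)[of 0 0 p] add(2)[of p 0 0] by simp_all
  have funpow_hom: "(\<sigma> ^^ i) (x * y) = (\<sigma> ^^ i) x * (\<sigma> ^^ i) y" "(\<sigma> ^^ i) 1 = 1" for i x y
  proof -
    interpret comm_ring_hom "\<sigma> ^^ i" by (rule comm_ring_hom_funpow[OF assms])
    show "(\<sigma> ^^ i) (x * y) = (\<sigma> ^^ i) x * (\<sigma> ^^ i) y" "(\<sigma> ^^ i) 1 = 1"
      by (simp_all add: hom_mult)
  qed
  have monom_0_1: "monom (1::'a) 0 = 1" by (simp add: monom_0)
  have one: "skew_mult \<sigma> 1 (monom b j) = monom b j" "skew_mult \<sigma> (monom b j) 1 = monom b j" for b j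
    using skew_mult_monom[OF assms, of 1 0 b j] skew_mult_monom[OF assms, of b j 1 0]
    by (simp_all add: monom_0_1 funpow_hom)
  have one_left: "skew_mult \<sigma> 1 p = p" for p
    by (induction p rule: monom_induct) (simp_all only: zero add one)
  have one_right: "skew_mult \<sigma> p 1 = p" for p
    by (induction p rule: monom_induct) (simp_all only: zero add one)
  have assoc1: "skew_mult \<sigma> (skew_mult \<sigma> (monom a i) (monom b j)) r =
      skew_mult \<sigma> (monom a i) (skew_mult \<sigma> (monom b j) r)" for a i b j r
    by (induction r rule: monom_induct)
      (simp_all add: zero add skew_mult_monom[OF assms] funpow_hom funpow_add ac_simps)
  have assoc2: "skew_mult \<sigma> (skew_mult \<sigma> (monom a i) q) r =
      skew_mult \<sigma> (monom a i) (skew_mult \<sigma> q r)" for a i q r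
    by (induction q rule: monom_induct) (simp_all only: zero add assoc1)
  have assoc: "skew_mult \<sigma> (skew_mult \<sigma> p q) r = skew_mult \<sigma> p (skew_mult \<sigma> q r)" for p q r
    by (induction p rule: monom_induct) (simp_all only: zero add assoc2)
  show ?thesis
  proof (rule ringI)
    show "abelian_group (skew_poly_ring \<sigma>)"
    proof (rule abelian_groupI)
      show "\<exists>y\<in>carrier (skew_poly_ring \<sigma>). y \<oplus>\<^bsub>skew_poly_ring \<sigma>\<^esub> x = \<zero>\<^bsub>skew_poly_ring \<sigma>\<^esub>" for x
        by (rule bexI[of _ "- x"]) (simp_all add: skew_poly_ring_def)
    qed (simp_all add: skew_poly_ring_def ac_simps)
    show "Group.monoid (skew_poly_ring \<sigma>)"
      by (rule monoidI) (simp_all add: skew_poly_ring_def one_left one_right assoc)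
  qed (simp_all add: skew_poly_ring_def add)
qed


section \<open>Codes\<close>

text \<open>
  \<^const>\<open>cgenideal\<close> is \<open>{q \<otimes> p | q. True}\<close>, which in the non-commutative ring
  \<^const>\<open>skew_poly_ring\<close> is the left ideal \<open>(p)\<^sub>l\<close>. It is only a subgroup in general, so the
  quotients by \<open>(X\<^sup>n - a)\<^sub>l\<close> are sets of additive cosets.
\<close>

definition constacyclic_code ::
  "('a::comm_ring_1 \<Rightarrow> 'a) \<Rightarrow> nat \<Rightarrow> 'a \<Rightarrow> 'a poly \<Rightarrow> 'a vec set" where
  "constacyclic_code \<sigma> n a g =
     (let S = skew_poly_ring \<sigma>; I = PIdl\<^bsub>S\<^esub> (monom 1 n - [:a:]) in
      {d \<in> carrier_vec n.
         I +>\<^bsub>S\<^esub> (\<Sum>i<n. monom (d $ i) i) \<in> (\<lambda>f. I +>\<^bsub>S\<^esub> f) ` (PIdl\<^bsub>S\<^esub> g)})"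

context vec_module
begin

definition generating_matrix :: "'a mat \<Rightarrow> 'a vec set \<Rightarrow> bool" where
  "generating_matrix G D \<longleftrightarrow>
     dim_col G = n \<and> distinct (rows G) \<and> lin_indpt (set (rows G)) \<and> span (set (rows G)) = D"

definition free_code :: "nat \<Rightarrow> 'a vec set \<Rightarrow> bool" where
  "free_code k C \<longleftrightarrow> (\<exists>G \<in> carrier_mat k n. generating_matrix G C)"

definition control_matrix :: "'a mat \<Rightarrow> 'a vec set \<Rightarrow> bool" where
  "control_matrix H C \<longleftrightarrow>
     dim_row H = n \<and> dim_col H \<le> n \<and>
     C = {x \<in> carrier_vec n. mat_of_row x * H = 0\<^sub>m 1 (dim_col H)}"

text \<open>
  Parity-check matrices are only defined for free codes of rank \<open>k\<close>, so this is part of the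
  predicate. \<^const>\<open>orthogonal_complement\<close> is the dual code.
\<close>

definition parity_check_matrix :: "nat \<Rightarrow> 'a mat \<Rightarrow> 'a vec set \<Rightarrow> bool" where
  "parity_check_matrix k H C \<longleftrightarrow>
     free_code k C \<and> H \<in> carrier_mat (n - k) n \<and>
     control_matrix H\<^sup>T C \<and> generating_matrix H (orthogonal_complement C)"

end

definition constacyclic_parity_matrix ::
  "('a::comm_ring_1 \<Rightarrow> 'a) \<Rightarrow> nat \<Rightarrow> nat \<Rightarrow> 'a poly \<Rightarrow> 'a mat" where
  "constacyclic_parity_matrix \<sigma> n k h =
     mat (n - k) n
       (\<lambda>(t, j). if t \<le> j \<and> j \<le> t + k then (\<sigma> ^^ j) (coeff h (t + k - j)) else 0)"

end

theory Submission
  imports Defs Jordan_Normal_Form.Matrix_Kernel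
begin

text \<open>
  Let \<open>X\<^sup>n - a = q g\<close> with \<open>n > 0\<close>; the case \<open>n = 0\<close> is trivial. A check polynomial is obtained by moving \<open>X\<^sup>n\<close> across \<open>q\<close>: take
  \<open>h\<close> with coefficients \<open>\<sigma>\<^sup>-\<^sup>n(q\<^sub>i)\<close>, so that \<open>X\<^sup>n h = q X\<^sup>n\<close>, and put \<open>b = \<sigma>\<^sup>-\<^sup>k(a)\<close>. Then
  \<open>q (g h - (X\<^sup>n - b)) = (X\<^sup>n - a) h - q X\<^sup>n + q b = q b - a h\<close>. Both \<open>q b\<close> and \<open>a h\<close> have
  coefficient \<open>a\<close> at degree \<open>k\<close>, so the right-hand side has degree below \<open>k\<close>; as \<open>q\<close> is monic of
  degree \<open>k\<close>, this forces \<open>g h = X\<^sup>n - b\<close> (lemma \<open>check_polynomial_exists\<close>).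

  For the parity-check property, let \<open>G\<close> be the \<open>k \<times> n\<close> matrix whose rows are the coefficient vectors
  of \<open>X\<^sup>i g\<close>. Multiplication by the monic \<open>g\<close> adds degrees, so the left multiples of \<open>g\<close> of degree
  below \<open>n\<close> are the combinations of these rows, and the code is the row span of \<open>G\<close>.
  The inner product of row \<open>i\<close> of \<open>G\<close> with row \<open>t\<close> of the claimed matrix \<open>H\<close> is \<open>\<sigma>\<^sup>i\<close> applied to
  the coefficient of \<open>g h\<close> at \<open>t + k - i\<close>; these exponents lie strictly between \<open>0\<close> and \<open>n\<close>, where
  \<open>X\<^sup>n - b\<close> has no terms, so \<open>H G\<^sup>T = 0\<close>.

  Orthogonality alone gives only inclusions. Over a field a dimension count would make them equalities;
  over a ring the shape of the matrices does this instead: since \<open>g\<close> and \<open>h\<close> are monic, the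
  last \<open>k\<close> columns of \<open>G\<close> and the first \<open>n - k\<close> columns of \<open>H\<close> are unitriangular, hence invertible.
  In coding terms these are complementary information sets. A vector killed by \<open>H\<close> can be corrected
  by a codeword to vanish on the last \<open>k\<close> positions, and is then zero because the remaining columns of
  \<open>H\<close> are invertible. The argument is symmetric in \<open>G\<close> and \<open>H\<close>, so it yields both that \<open>H\<^sup>T\<close> is a
  control matrix and that \<open>H\<close> generates the dual (lemma \<open>parity_check_matrix_row_span\<close>).
\<close>

section \<open>Matrices with complementary information sets\<close>

text \<open>
  The square block in columns \<open>s, s + 1, \<dots>\<close> of \<open>M\<close>. When its determinant is a unit, these positions
  form an information set of the code spanned by the rows of \<open>M\<close>: a codeword is determined by its
  entries there, and these entries can be prescribed freely.
\<close>

definition column_block :: "'a mat \<Rightarrow> nat \<Rightarrow> 'a mat" where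
  "column_block M s = mat (dim_row M) (dim_row M) (\<lambda>(i, j). M $$ (i, s + j))"

text \<open>
  The set of linear combinations of the rows, presented as the image of the encoder \<open>v \<mapsto> M\<^sup>T v\<close>. In
  this form it involves no set of rows, hence no question of repeated rows.
\<close>

definition row_span :: "'a::comm_ring_1 mat \<Rightarrow> 'a vec set" where
  "row_span M = {M\<^sup>T *\<^sub>v v | v. v \<in> carrier_vec (dim_row M)}"

lemma column_block_carrier [simp]:
  "M \<in> carrier_mat r n \<Longrightarrow> column_block M s \<in> carrier_mat r r"
  by (simp add: column_block_def)

text \<open>
  Over a commutative ring a unit determinant suffices for invertibility, because the adjugate satisfies
  \<open>B adj(B) = det(B) 1\<close>.
\<close>

lemma inverse_mat_of_det_unit:
  fixes B :: "'a::comm_ring_1 mat"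
  assumes "B \<in> carrier_mat r r" "det B dvd 1"
  obtains C where "C \<in> carrier_mat r r" "B * C = 1\<^sub>m r" "C * B = 1\<^sub>m r"
proof -
  obtain u where u: "det B * u = 1"
    using assms(2) by (metis dvdE)
  note adj = adj_mat[OF assms(1)]
  show ?thesis
  proof
    show "u \<cdot>\<^sub>m adj_mat B \<in> carrier_mat r r"
      using adj(1) by simp
    show "B * (u \<cdot>\<^sub>m adj_mat B) = 1\<^sub>m r"
      using mult_smult_distrib[OF assms(1) adj(1), of u] adj(2) u
      by (auto simp: mult.commute intro!: eq_matI)
    show "(u \<cdot>\<^sub>m adj_mat B) * B = 1\<^sub>m r"
      using mult_smult_assoc_mat[OF adj(1) assms(1), of u] adj(3) u
      by (auto simp: mult.commute intro!: eq_matI)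
  qed
qed

lemma mult_mat_vec_eq_0_unit_det:
  fixes B :: "'a::comm_ring_1 mat"
  assumes B: "B \<in> carrier_mat r r" "det B dvd 1" and v: "v \<in> carrier_vec r"
    and eq: "B *\<^sub>v v = 0\<^sub>v r"
  shows "v = 0\<^sub>v r"
proof -
  obtain C where C: "C \<in> carrier_mat r r" "C * B = 1\<^sub>m r"
    using inverse_mat_of_det_unit[OF B] by metis
  have "v = (C * B) *\<^sub>v v"
    using v C by simp
  also have "\<dots> = C *\<^sub>v (B *\<^sub>v v)"
    using assoc_mult_mat_vec[OF C(1) B(1) v] .
  finally show ?thesis
    using C eq by (auto intro!: eq_vecI)
qed

lemma transpose_mult_vec_column_block:
  fixes M :: "'a::comm_ring_1 mat"
  assumes "M \<in> carrier_mat r n" "s + r \<le> n" "v \<in> carrier_vec r" "j < r"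
  shows "(M\<^sup>T *\<^sub>v v) $ (s + j) = ((column_block M s)\<^sup>T *\<^sub>v v) $ j"
  using assms by (simp add: column_block_def scalar_prod_def)

lemma encode_inj:
  fixes M :: "'a::comm_ring_1 mat"
  assumes M: "M \<in> carrier_mat r n" "s + r \<le> n" "det (column_block M s) dvd 1"
    and v: "v \<in> carrier_vec r" and eq: "M\<^sup>T *\<^sub>v v = 0\<^sub>v n"
  shows "v = 0\<^sub>v r"
proof (rule mult_mat_vec_eq_0_unit_det[of "(column_block M s)\<^sup>T"])
  show "(column_block M s)\<^sup>T *\<^sub>v v = 0\<^sub>v r"
  proof
    fix j assume "j < dim_vec (0\<^sub>v r :: 'a vec)"
    then show "((column_block M s)\<^sup>T *\<^sub>v v) $ j = 0\<^sub>v r $ j"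
      using transpose_mult_vec_column_block[OF M(1,2) v, of j] eq M(2) by simp
  qed (use M in \<open>simp add: column_block_def\<close>)
qed (use M v det_transpose[OF column_block_carrier[OF M(1)]] in simp_all)

lemma encode_prescribed:
  fixes M :: "'a::comm_ring_1 mat"
  assumes M: "M \<in> carrier_mat r n" "s + r \<le> n" "det (column_block M s) dvd 1"
  obtains v where "v \<in> carrier_vec r" "\<And>j. j < r \<Longrightarrow> (M\<^sup>T *\<^sub>v v) $ (s + j) = x $ (s + j)"
proof -
  let ?B = "(column_block M s)\<^sup>T"
  let ?y = "vec r (\<lambda>j. x $ (s + j))"
  have B: "?B \<in> carrier_mat r r" "det ?B dvd 1"
    using M det_transpose[OF column_block_carrier[OF M(1)]] by simp_all
  obtain C where C: "C \<in> carrier_mat r r" "?B * C = 1\<^sub>m r"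
    using inverse_mat_of_det_unit[OF B] by metis
  have v: "C *\<^sub>v ?y \<in> carrier_vec r"
    using C by simp
  have "?B *\<^sub>v (C *\<^sub>v ?y) = ?y"
    using assoc_mult_mat_vec[OF B(1) C(1), of ?y] C by simp
  then have "(M\<^sup>T *\<^sub>v (C *\<^sub>v ?y)) $ (s + j) = x $ (s + j)" if "j < r" for j
    using transpose_mult_vec_column_block[OF M(1,2) v that] that by simp
  with v show ?thesis
    using that by blast
qed

text \<open>
  On a vector supported in the information set, \<open>M\<close> acts through its invertible block.
\<close>

lemma kernel_supported_on_information_set:
  fixes M :: "'a::comm_ring_1 mat"
  assumes M: "M \<in> carrier_mat r n" "s + r \<le> n" "det (column_block M s) dvd 1"
    and x: "x \<in> mat_kernel M" and supp: "\<And>j. j < n \<Longrightarrow> j \<notin> {s..<s + r} \<Longrightarrow> x $ j = 0"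
  shows "x = 0\<^sub>v n"
proof -
  let ?y = "vec r (\<lambda>j. x $ (s + j))"
  have xn: "x \<in> carrier_vec n" and x0: "M *\<^sub>v x = 0\<^sub>v r"
    using mat_kernelD[OF M(1) x] by auto
  have "column_block M s *\<^sub>v ?y = 0\<^sub>v r"
  proof
    fix i assume "i < dim_vec (0\<^sub>v r :: 'a vec)"
    then have i: "i < r" by simp
    have "(\<Sum>j\<in>{0..<r}. M $$ (i, s + j) * x $ (s + j)) = (\<Sum>j\<in>{s..<s + r}. M $$ (i, j) * x $ j)"
      using sum.shift_bounds_nat_ivl[of "\<lambda>j. M $$ (i, j) * x $ j" 0 s r]
      by (simp add: add.commute)
    also have "\<dots> = (\<Sum>j\<in>{0..<n}. M $$ (i, j) * x $ j)"
      by (rule sum.mono_neutral_left) (use M(2) supp in auto)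
    also have "\<dots> = (M *\<^sub>v x) $ i"
      using M(1) i xn by (simp add: scalar_prod_def)
    finally show "(column_block M s *\<^sub>v ?y) $ i = 0\<^sub>v r $ i"
      using M(1) i x0 by (simp add: column_block_def scalar_prod_def)
  qed (use M in \<open>simp add: column_block_def\<close>)
  then have "?y = 0\<^sub>v r"
    using mult_mat_vec_eq_0_unit_det[OF column_block_carrier[OF M(1)] M(3)] by simp
  then have "x $ (s + j) = 0" if "j < r" for j
    using that by (metis index_vec index_zero_vec(1))
  then have "x $ j = 0" if "j < n" for j
    using supp[OF that] by (cases "j \<in> {s..<s + r}") (auto simp: le_iff_add)
  then show ?thesis
    using xn by auto
qed

text \<open>
  Orthogonality gives one inclusion. For the other, subtract from a vector in the kernel of \<open>H\<close> the
  codeword of \<open>G\<close> that agrees with it on the information set of \<open>G\<close>; the difference lies in the kernel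
  and is supported on the information set of \<open>H\<close>, so it vanishes.
\<close>

lemma mat_kernel_eq_row_span:
  fixes G H :: "'a::comm_ring_1 mat"
  assumes G: "G \<in> carrier_mat r n" "s + r \<le> n" "det (column_block G s) dvd 1"
    and H: "H \<in> carrier_mat r' n" "s' + r' \<le> n" "det (column_block H s') dvd 1"
    and cover: "{..<n} \<subseteq> {s..<s + r} \<union> {s'..<s' + r'}"
    and orth: "H * G\<^sup>T = 0\<^sub>m r' r"
  shows "mat_kernel H = row_span G"
proof
  have code_in_kernel: "G\<^sup>T *\<^sub>v v \<in> mat_kernel H" if v: "v \<in> carrier_vec r" for v
  proof (rule mat_kernelI[OF H(1)])
    show "H *\<^sub>v (G\<^sup>T *\<^sub>v v) = 0\<^sub>v r'"
      using assoc_mult_mat_vec[OF H(1) _ v, of "G\<^sup>T", symmetric] G(1) orth v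
      by (auto intro!: eq_vecI)
  qed (use G v in auto)
  then show "row_span G \<subseteq> mat_kernel H"
    using G(1) by (auto simp: row_span_def)
  show "mat_kernel H \<subseteq> row_span G"
  proof
    fix x assume x: "x \<in> mat_kernel H"
    obtain v where v: "v \<in> carrier_vec r"
      and agree: "\<And>j. j < r \<Longrightarrow> (G\<^sup>T *\<^sub>v v) $ (s + j) = x $ (s + j)"
      using encode_prescribed[OF G, of x] by metis
    let ?c = "G\<^sup>T *\<^sub>v v"
    have xn: "x \<in> carrier_vec n" "?c \<in> carrier_vec n"
      and ker: "H *\<^sub>v x = 0\<^sub>v r'" "H *\<^sub>v ?c = 0\<^sub>v r'"
      using mat_kernelD[OF H(1) x] mat_kernelD[OF H(1) code_in_kernel[OF v]] by auto
    have "x - ?c = 0\<^sub>v n"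
    proof (rule kernel_supported_on_information_set[OF H])
      show "x - ?c \<in> mat_kernel H"
        using mult_minus_distrib_mat_vec[OF H(1) xn] ker xn
        by (intro mat_kernelI[OF H(1)]) auto
      fix j assume "j < n" "j \<notin> {s'..<s' + r'}"
      moreover from this have "j \<in> {s..<s + r}"
        using cover by auto
      ultimately show "(x - ?c) $ j = 0"
        using agree[of "j - s"] xn G(1) by auto
    qed
    then have "(x - ?c) $ i = 0" if "i < n" for i
      using that by simp
    then have "x = ?c"
      using xn G(1) by (intro eq_vecI) auto
    then show "x \<in> row_span G"
      using v G(1) by (auto simp: row_span_def)
  qed
qed

section \<open>Parity-check matrices from complementary information sets\<close>

lemma (in vec_module) lincomb_rows:
  assumes M: "M \<in> carrier_mat r n" "distinct (rows M)"
  shows "lincomb f (set (rows M)) = M\<^sup>T *\<^sub>v vec r (\<lambda>i. f (row M i))"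
proof -
  have sub: "set (rows M) \<subseteq> carrier_vec n"
    using M by (auto simp: rows_def)
  have "mat_of_cols n (rows M) = M\<^sup>T"
    using M(1) transpose_mat_of_rows[of n "rows M"] by auto
  moreover have "vec (length (rows M)) (\<lambda>i. f (rows M ! i)) = vec r (\<lambda>i. f (row M i))"
    using M(1) by auto
  ultimately show ?thesis
    using lincomb_as_lincomb_list_distinct[OF sub M(2), of f]
      lincomb_list_as_mat_mult[of "rows M" "\<lambda>i. f (rows M ! i)"] sub by fastforce
qed

text \<open>
  Injectivity of the encoder gives linear independence directly, and also distinctness of the rows: two
  equal rows at \<open>i \<noteq> j\<close> would put the difference of the unit vectors at \<open>i\<close> and \<open>j\<close> into its kernel.
\<close>

lemma (in vec_module) generating_matrix_row_span:
  assumes M: "(M :: 'a mat) \<in> carrier_mat r n"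
    and inj: "\<And>v. v \<in> carrier_vec r \<Longrightarrow> M\<^sup>T *\<^sub>v v = 0\<^sub>v n \<Longrightarrow> v = 0\<^sub>v r"
  shows "generating_matrix M (row_span M)"
proof -
  have MT: "M\<^sup>T \<in> carrier_mat n r"
    using M by simp
  have sub: "set (rows M) \<subseteq> carrier_vec n"
    using M by (auto simp: rows_def)
  have unit: "M\<^sup>T *\<^sub>v unit_vec r i = row M i" if "i < r" for i
    using that M by (intro eq_vecI) auto
  have row_inj: "i = j" if ij: "i < r" "j < r" and eq: "row M i = row M j" for i j
  proof (rule ccontr)
    assume "i \<noteq> j"
    have "M\<^sup>T *\<^sub>v (unit_vec r i - unit_vec r j) = row M i - row M j"
      using mult_minus_distrib_mat_vec[OF MT, of "unit_vec r i" "unit_vec r j"] unit ij by simp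
    also have "\<dots> = 0\<^sub>v n"
      using eq M by (auto intro!: eq_vecI)
    finally have "unit_vec r i - unit_vec r j = (0\<^sub>v r :: 'a vec)"
      by (intro inj) auto
    then have "(unit_vec r i - unit_vec r j :: 'a vec) $ i = 0"
      using ij by simp
    then show False
      using ij \<open>i \<noteq> j\<close> by simp
  qed
  have dist: "distinct (rows M)"
    using M row_inj by (simp add: rows_def distinct_map inj_on_def)
  have "lin_indpt (set (rows M))"
  proof (rule finite_lin_indpt2[OF _ sub])
    fix f assume "lincomb f (set (rows M)) = 0\<^sub>v n"
    then have "vec r (\<lambda>i. f (row M i)) = 0\<^sub>v r"
      using lincomb_rows[OF M dist] by (intro inj) auto
    then have "f (row M i) = 0" if "i < r" for i
      using that by (metis index_vec index_zero_vec(1))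
    then show "\<forall>v\<in>set (rows M). f v = 0"
      using M by (auto simp: rows_def)
  qed simp
  moreover have "span (set (rows M)) = row_span M"
  proof
    show "span (set (rows M)) \<subseteq> row_span M"
      using finite_span[OF _ sub] lincomb_rows[OF M dist] M by (auto simp: row_span_def)
    show "row_span M \<subseteq> span (set (rows M))"
    proof
      fix x assume "x \<in> row_span M"
      then obtain v where v: "v \<in> carrier_vec r" "x = M\<^sup>T *\<^sub>v v"
        using M by (auto simp: row_span_def)
      \<comment> \<open>coefficients indexed by positions become coefficients indexed by rows, as rows are distinct\<close>
      define f where "f w = v $ (THE i. i < r \<and> row M i = w)" for w
      have "f (row M i) = v $ i" if "i < r" for i
      proof -
        have "(THE j. j < r \<and> row M j = row M i) = i"
          using that row_inj by (intro the_equality) auto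
        then show ?thesis
          by (simp add: f_def)
      qed
      then have "vec r (\<lambda>i. f (row M i)) = v"
        using v(1) by auto
      then have "x = lincomb f (set (rows M))"
        using lincomb_rows[OF M dist, of f] v(2) by simp
      then show "x \<in> span (set (rows M))"
        using finite_span[OF _ sub] by auto
    qed
  qed
  ultimately show ?thesis
    using M dist by (simp add: generating_matrix_def)
qed

lemma (in vec_module) orthogonal_complement_row_span:
  assumes G: "(G :: 'a mat) \<in> carrier_mat r n"
  shows "orthogonal_complement (row_span G) = mat_kernel G"
proof -
  have adjoint: "x \<bullet> (G\<^sup>T *\<^sub>v v) = (G *\<^sub>v x) \<bullet> v" if "x \<in> carrier_vec n" "v \<in> carrier_vec r" for x v
    using transpose_vec_mult_scalar[OF G that] G that
    by (metis comm_scalar_prod mult_mat_vec_carrier transpose_carrier_mat)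
  have nondeg: "y = 0\<^sub>v r" if "y \<in> carrier_vec r" "\<And>v. v \<in> carrier_vec r \<Longrightarrow> y \<bullet> v = 0" for y :: "'a vec"
  proof
    fix i assume "i < dim_vec (0\<^sub>v r :: 'a vec)"
    then show "y $ i = 0\<^sub>v r $ i"
      using that(2)[of "unit_vec r i"] that(1) by simp
  qed (use that in simp)
  have "x \<in> orthogonal_complement (row_span G) \<longleftrightarrow> x \<in> mat_kernel G" for x
  proof (cases "x \<in> carrier_vec n")
    case True
    have "x \<in> orthogonal_complement (row_span G) \<longleftrightarrow> (\<forall>v\<in>carrier_vec r. (G *\<^sub>v x) \<bullet> v = 0)"
      using True G adjoint[OF True] by (auto simp: orthogonal_complement_def row_span_def)
    also have "\<dots> \<longleftrightarrow> G *\<^sub>v x = 0\<^sub>v r"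
      using nondeg[of "G *\<^sub>v x"] True G by auto
    finally show ?thesis
      using True by (simp add: mat_kernel[OF G])
  next
    case False
    then show ?thesis
      by (simp add: orthogonal_complement_def mat_kernel[OF G])
  qed
  then show ?thesis
    by blast
qed

lemma (in vec_module) control_matrix_transpose_iff:
  assumes H: "(H :: 'a mat) \<in> carrier_mat r n" "r \<le> n"
  shows "control_matrix H\<^sup>T C \<longleftrightarrow> C = mat_kernel H"
proof -
  have "mat_of_row x * H\<^sup>T = 0\<^sub>m 1 r \<longleftrightarrow> H *\<^sub>v x = 0\<^sub>v r" if x: "x \<in> carrier_vec n" for x
  proof -
    have "(mat_of_row x * H\<^sup>T) $$ (0, i) = (H *\<^sub>v x) $ i" if "i < r" for i
      using that x H(1) comm_scalar_prod[of x n "row H i"] by simp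
    then show ?thesis
      using H(1) x by (auto simp: mat_eq_iff vec_eq_iff)
  qed
  then show ?thesis
    using H by (auto simp: control_matrix_def mat_kernel[OF H(1)])
qed

text \<open>
  The symmetric use of complementary information sets: with the roles \<open>(G, H)\<close> it identifies the code
  as the kernel of \<open>H\<close>, with the roles \<open>(H, G)\<close> it identifies the dual, which is the kernel of \<open>G\<close>, as the
  row span of \<open>H\<close>.
\<close>

lemma (in vec_module) parity_check_matrix_row_span:
  fixes G H :: "'a mat"
  assumes k: "k \<le> n"
    and G: "G \<in> carrier_mat k n" "det (column_block G (n - k)) dvd 1"
    and H: "H \<in> carrier_mat (n - k) n" "det (column_block H 0) dvd 1"
    and orth: "H * G\<^sup>T = 0\<^sub>m (n - k) k"
  shows "parity_check_matrix k H (row_span G)"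
proof -
  have G': "n - k + k \<le> n" and H': "0 + (n - k) \<le> n"
    using k by auto
  have "G * H\<^sup>T = (H * G\<^sup>T)\<^sup>T"
    using transpose_mult[OF H(1), of "G\<^sup>T" k] G(1) by simp
  then have orth': "G * H\<^sup>T = 0\<^sub>m k (n - k)"
    using orth by simp
  have "mat_kernel H = row_span G"
    by (rule mat_kernel_eq_row_span[OF G(1) G' G(2) H(1) H' H(2) _ orth]) auto
  moreover have "mat_kernel G = row_span H"
    by (rule mat_kernel_eq_row_span[OF H(1) H' H(2) G(1) G' G(2) _ orth']) auto
  moreover have "generating_matrix G (row_span G)"
    by (rule generating_matrix_row_span[OF G(1) encode_inj[OF G(1) G' G(2)]])
  moreover have "generating_matrix H (row_span H)"
    by (rule generating_matrix_row_span[OF H(1) encode_inj[OF H(1) H' H(2)]])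
  ultimately show ?thesis
    using G(1) H(1) orthogonal_complement_row_span[OF G(1)]
      control_matrix_transpose_iff[OF H(1)]
    by (auto simp: parity_check_matrix_def free_code_def)
qed

section \<open>Products of skew polynomials\<close>

context
  fixes \<sigma> :: "'a::comm_ring_1 \<Rightarrow> 'a"
  assumes hom: "comm_ring_hom \<sigma>"
begin

lemma funpow_hom_simps:
  "(\<sigma> ^^ i) 0 = 0" "(\<sigma> ^^ i) 1 = 1" "(\<sigma> ^^ i) (x * y) = (\<sigma> ^^ i) x * (\<sigma> ^^ i) y"
  "(\<sigma> ^^ i) (- x) = - (\<sigma> ^^ i) x"
  "(\<sigma> ^^ i) (sum f A) = (\<Sum>j\<in>A. (\<sigma> ^^ i) (f j))"
proof -
  interpret comm_ring_hom "\<sigma> ^^ i"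
    by (rule comm_ring_hom_funpow[OF hom])
  show "(\<sigma> ^^ i) 0 = 0" "(\<sigma> ^^ i) 1 = 1" "(\<sigma> ^^ i) (x * y) = (\<sigma> ^^ i) x * (\<sigma> ^^ i) y"
    "(\<sigma> ^^ i) (- x) = - (\<sigma> ^^ i) x" "(\<sigma> ^^ i) (sum f A) = (\<Sum>j\<in>A. (\<sigma> ^^ i) (f j))"
    by (simp_all add: hom_distribs)
qed

lemma skew_mult_assoc: "skew_mult \<sigma> (skew_mult \<sigma> p q) r = skew_mult \<sigma> p (skew_mult \<sigma> q r)"
proof -
  interpret ring "skew_poly_ring \<sigma>"
    by (rule ring_skew_poly_ring[OF hom])
  show ?thesis
    using m_assoc[of p q r] by (simp add: skew_poly_ring_def)
qed

lemma skew_mult_minus_left: "skew_mult \<sigma> (- p) q = - skew_mult \<sigma> p q"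
  by (rule poly_eqI) (simp add: coeff_skew_mult[OF hom] sum_negf)

lemma skew_mult_minus_right: "skew_mult \<sigma> p (- q) = - skew_mult \<sigma> p q"
  by (rule poly_eqI) (simp add: coeff_skew_mult[OF hom] funpow_hom_simps sum_negf)

lemma skew_mult_diff_left: "skew_mult \<sigma> (p - q) r = skew_mult \<sigma> p r - skew_mult \<sigma> q r"
  using skew_mult_add_left[OF hom, of p "- q" r] by (simp add: skew_mult_minus_left)

lemma skew_mult_diff_right: "skew_mult \<sigma> p (q - r) = skew_mult \<sigma> p q - skew_mult \<sigma> p r"
  using skew_mult_add_right[OF hom, of p q "- r"] by (simp add: skew_mult_minus_right)

text \<open>
  The number of summands is made independent of \<open>m\<close>, to match the fixed length of a message vector.
\<close>

lemma coeff_skew_mult_lessThan: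
  assumes "\<And>i. N \<le> i \<Longrightarrow> i \<le> m \<Longrightarrow> coeff p i = 0"
  shows "coeff (skew_mult \<sigma> p q) m =
    (\<Sum>i<N. if i \<le> m then coeff p i * (\<sigma> ^^ i) (coeff q (m - i)) else 0)"
proof -
  have "(\<Sum>i\<le>m. coeff p i * (\<sigma> ^^ i) (coeff q (m - i))) =
      (\<Sum>i \<in> {..m} \<inter> {..<N}. coeff p i * (\<sigma> ^^ i) (coeff q (m - i)))"
  proof (rule sum.mono_neutral_right, goal_cases)
    case 3
    then show ?case
      by (clarsimp simp: assms not_less)
  qed auto
  also have "\<dots> = (\<Sum>i<N. if i \<le> m then coeff p i * (\<sigma> ^^ i) (coeff q (m - i)) else 0)"
    by (rule sum.mono_neutral_cong_left) auto
  finally show ?thesis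
    by (simp add: coeff_skew_mult[OF hom])
qed

lemma coeff_monom_skew_mult:
  "coeff (skew_mult \<sigma> (monom c i) p) m = (if i \<le> m then c * (\<sigma> ^^ i) (coeff p (m - i)) else 0)"
proof -
  have "(\<Sum>l\<le>m. coeff (monom c i) l * (\<sigma> ^^ l) (coeff p (m - l))) =
      (\<Sum>l\<le>m. if l = i then c * (\<sigma> ^^ i) (coeff p (m - i)) else 0)"
    by (rule sum.cong) auto
  then show ?thesis
    by (simp add: coeff_skew_mult[OF hom])
qed

lemma coeff_skew_mult_monom:
  "coeff (skew_mult \<sigma> p (monom c j)) m =
    (if j \<le> m then coeff p (m - j) * (\<sigma> ^^ (m - j)) c else 0)"
proof -
  have "(\<Sum>l\<le>m. coeff p l * (\<sigma> ^^ l) (coeff (monom c j) (m - l))) =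
      (\<Sum>l\<le>m. if l = m - j then (if j \<le> m then coeff p (m - j) * (\<sigma> ^^ (m - j)) c else 0) else 0)"
    by (rule sum.cong) (auto simp: funpow_hom_simps)
  then show ?thesis
    by (simp add: coeff_skew_mult[OF hom])
qed

lemma coeff_skew_mult_top:
  assumes "degree p \<le> d" "degree q \<le> e"
  shows "coeff (skew_mult \<sigma> p q) (d + e) = coeff p d * (\<sigma> ^^ d) (coeff q e)"
proof -
  have "coeff p i * (\<sigma> ^^ i) (coeff q (d + e - i)) = 0" if "i \<noteq> d" for i
  proof (cases "i < d")
    case True
    then have "coeff q (d + e - i) = 0"
      using assms by (intro coeff_eq_0) auto
    then show ?thesis
      by (simp add: funpow_hom_simps)
  next
    case False
    then have "coeff p i = 0"
      using assms that by (intro coeff_eq_0) auto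
    then show ?thesis
      by simp
  qed
  then have "(\<Sum>i\<le>d + e. coeff p i * (\<sigma> ^^ i) (coeff q (d + e - i))) =
      (\<Sum>i\<le>d + e. if i = d then coeff p d * (\<sigma> ^^ d) (coeff q e) else 0)"
    by (intro sum.cong) auto
  then show ?thesis
    by (simp add: coeff_skew_mult[OF hom])
qed

lemma degree_skew_mult_le: "degree (skew_mult \<sigma> p q) \<le> degree p + degree q"
proof (rule degree_le, intro allI impI)
  fix m assume m: "degree p + degree q < m"
  have "coeff p i * (\<sigma> ^^ i) (coeff q (m - i)) = 0" for i
    by (cases "degree p < i") (use m in \<open>auto simp: coeff_eq_0 funpow_hom_simps\<close>)
  then show "coeff (skew_mult \<sigma> p q) m = 0"
    by (simp add: coeff_skew_mult[OF hom])
qed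

text \<open>
  The ring may have zero divisors, but the leading coefficient of \<open>p g\<close> is that of \<open>p\<close> times
  \<open>\<sigma>\<^sup>i(1) = 1\<close>, so it does not vanish.
\<close>

lemma degree_skew_mult_monic:
  assumes "lead_coeff g = 1" "p \<noteq> 0"
  shows "degree (skew_mult \<sigma> p g) = degree p + degree g"
proof (rule antisym[OF degree_skew_mult_le le_degree])
  show "coeff (skew_mult \<sigma> p g) (degree p + degree g) \<noteq> 0"
    using assms coeff_skew_mult_top[of p "degree p" g "degree g"] by (simp add: funpow_hom_simps)
qed

end

section \<open>The check polynomial\<close>

text \<open>
  The twist by \<open>\<sigma>\<^sup>-\<^sup>n\<close> makes \<open>X\<^sup>n h = q X\<^sup>n\<close>, and the twist in \<open>b = \<sigma>\<^sup>-\<^sup>k(a)\<close> makes the degree-\<open>k\<close> terms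
  of \<open>q b\<close> and \<open>a h\<close> cancel. Left cancellation of the monic \<open>q\<close> is done by looking at the product of
  the leading coefficients.
\<close>

lemma check_polynomial_exists:
  fixes \<sigma> :: "'a::comm_ring_1 \<Rightarrow> 'a"
  assumes isom: "comm_ring_isom \<sigma>"
    and g: "lead_coeff g = 1" "degree g = n - k" and k: "k \<le> n"
    and q: "skew_mult \<sigma> q g = monom 1 n - [:a:]"
  shows "\<exists>h. degree h \<le> k \<and> skew_mult \<sigma> g h = monom 1 n - [:(inv_into UNIV \<sigma> ^^ k) a:]"
proof -
  interpret comm_ring_isom \<sigma> by (rule isom)
  have hom: "comm_ring_hom \<sigma>" ..
  note [simp] = funpow_hom_simps[OF hom]
  have inv_funpow: "(\<sigma> ^^ i) ((inv_into UNIV \<sigma> ^^ i) x) = x" for i x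
    using inv_fn[OF bij, of i] bij_fn[OF bij, of i] by (metis bij_is_surj surj_f_inv_f)
  have funpow_inv: "(inv_into UNIV \<sigma> ^^ i) ((\<sigma> ^^ i) x) = x" for i x
    using inv_fn[OF bij, of i] bij_fn[OF bij, of i] by (metis bij_is_inj Hilbert_Choice.inv_f_f)
  show ?thesis
  proof (cases "n = 0")
    \<comment> \<open>here \<open>X\<^sup>n - a\<close> is the constant \<open>1 - a\<close>, so \<open>q\<close> need not be monic\<close>
    case True
    then have "g = monom 1 0"
      using g k by (metis degree_0_id diff_0_eq_0 monom_0)
    moreover have "k = 0"
      using True k by simp
    moreover have "skew_mult \<sigma> (monom 1 0) p = p" for p
      by (rule poly_eqI) (simp add: coeff_monom_skew_mult[OF hom] del: monom_eq_1)
    ultimately show ?thesis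
      using True by (intro exI[of _ "monom 1 0 - [:a:]"]) (simp add: monom_0)
  next
    case False
    define b where "b = (inv_into UNIV \<sigma> ^^ k) a"
    define h where "h = map_poly (inv_into UNIV \<sigma> ^^ n) q"
    define f where "f = skew_mult \<sigma> g h - (monom 1 n - [:b:])"
    have coeff_h: "coeff h i = (inv_into UNIV \<sigma> ^^ n) (coeff q i)" for i
      using funpow_inv[of n 0] by (simp add: h_def coeff_map_poly)
    have "q \<noteq> 0"
    proof
      assume "q = 0"
      then have "coeff (monom 1 n - [:a:]) n = coeff (skew_mult \<sigma> 0 g) n"
        using q by simp
      then show False
        using False by (simp add: coeff_skew_mult[OF hom] coeff_pCons split: nat.splits)
    qed
    then have "degree q + (n - k) = degree (monom 1 n - [:a:])"
      using degree_skew_mult_monic[OF hom g(1), of q] q g(2) by simp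
    also have "\<dots> \<le> n"
      by (rule degree_diff_le) (simp_all add: degree_monom_le)
    finally have deg_q: "degree q \<le> k"
      using k by simp
    have "coeff (skew_mult \<sigma> q g) (k + (n - k)) = coeff q k"
      using coeff_skew_mult_top[OF hom deg_q, of g "n - k"] g by simp
    then have q_k: "coeff q k = 1"
      using q k False by (simp add: coeff_pCons split: nat.splits)
    have deg_h: "degree h \<le> k"
      using coeff_h deg_q funpow_inv[of n 0] by (intro degree_le) (simp add: coeff_eq_0)
    have h_k: "coeff h k = 1"
      using coeff_h q_k funpow_inv[of n 1] by simp
    have shift: "skew_mult \<sigma> (monom 1 n) h = skew_mult \<sigma> q (monom 1 n)"
      by (rule poly_eqI)
        (simp add: coeff_monom_skew_mult[OF hom] coeff_skew_mult_monom[OF hom] coeff_h inv_funpow)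
    \<comment> \<open>\<open>f\<close> measures the failure of \<open>g h = X\<^sup>n - b\<close>; \<open>q f\<close> turns out to be \<open>q b - a h\<close>\<close>
    have "skew_mult \<sigma> q f =
        skew_mult \<sigma> (skew_mult \<sigma> q g) h - (skew_mult \<sigma> q (monom 1 n) - skew_mult \<sigma> q [:b:])"
      by (simp add: f_def skew_mult_diff_right[OF hom] skew_mult_assoc[OF hom])
    also have "\<dots> = skew_mult \<sigma> q (monom b 0) - skew_mult \<sigma> (monom a 0) h"
      by (simp add: q skew_mult_diff_left[OF hom] shift monom_0)
    finally have qf: "coeff (skew_mult \<sigma> q f) m = coeff q m * (\<sigma> ^^ m) b - a * coeff h m" for m
      by (simp add: coeff_monom_skew_mult[OF hom] coeff_skew_mult_monom[OF hom])
    have "coeff (skew_mult \<sigma> q f) m = 0" if "k \<le> m" for m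
    proof (cases "m = k")
      case True
      then show ?thesis
        using qf q_k h_k inv_funpow[of k a] by (simp add: b_def)
    next
      case False
      then show ?thesis
        using qf that deg_q deg_h by (simp add: coeff_eq_0)
    qed
    then have "(\<sigma> ^^ k) (lead_coeff f) = 0"
      using coeff_skew_mult_top[OF hom deg_q order_refl, of f] q_k by simp
    then have "f = 0"
      using funpow_inv[of k "lead_coeff f"] funpow_inv[of k 0] by simp
    then have "skew_mult \<sigma> g h = monom 1 n - [:b:]"
      by (simp add: f_def)
    then show ?thesis
      using deg_h b_def by blast
  qed
qed

section \<open>The generator matrix of a constacyclic code\<close>

text \<open>
  Row \<open>i\<close> holds the coefficients of \<open>X\<^sup>i g\<close>, since \<open>X\<^sup>i g\<^sub>l = \<sigma>\<^sup>i(g\<^sub>l) X\<^sup>i\<close>.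
\<close>

definition constacyclic_generator_matrix ::
  "('a::comm_ring_1 \<Rightarrow> 'a) \<Rightarrow> nat \<Rightarrow> nat \<Rightarrow> 'a poly \<Rightarrow> 'a mat" where
  "constacyclic_generator_matrix \<sigma> n k g =
     mat k n (\<lambda>(i, j). if i \<le> j then (\<sigma> ^^ i) (coeff g (j - i)) else 0)"

definition vec_poly :: "nat \<Rightarrow> 'a::comm_ring_1 vec \<Rightarrow> 'a poly" where
  "vec_poly m v = (\<Sum>i<m. monom (v $ i) i)"

lemma coeff_vec_poly: "coeff (vec_poly m v) j = (if j < m then v $ j else 0)"
  by (simp add: vec_poly_def coeff_sum)

text \<open>
  Because \<open>X\<^sup>n - a = q g\<close> lies in the left ideal of \<open>g\<close>, passing to cosets of \<open>(X\<^sup>n - a)\<^sub>l\<close> does not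
  change which polynomials belong to the code.
\<close>

lemma mem_constacyclic_code_iff:
  fixes \<sigma> :: "'a::comm_ring_1 \<Rightarrow> 'a"
  assumes hom: "comm_ring_hom \<sigma>" and q: "skew_mult \<sigma> q g = monom 1 n - [:a:]"
  shows "d \<in> constacyclic_code \<sigma> n a g \<longleftrightarrow>
    d \<in> carrier_vec n \<and> (\<exists>p. vec_poly n d = skew_mult \<sigma> p g)"
proof -
  let ?S = "skew_poly_ring \<sigma>"
  let ?I = "PIdl\<^bsub>?S\<^esub> (monom 1 n - [:a:])"
  have I: "?I = {skew_mult \<sigma> u (skew_mult \<sigma> q g) |u. True}"
    and gl: "PIdl\<^bsub>?S\<^esub> g = {skew_mult \<sigma> u g |u. True}"
    by (simp_all add: cgenideal_def skew_poly_ring_def q)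
  have coset: "?I +>\<^bsub>?S\<^esub> p = {skew_mult \<sigma> u (skew_mult \<sigma> q g) + p |u. True}" for p
    unfolding I a_r_coset_def' by (auto simp: skew_poly_ring_def)
  have "(?I +>\<^bsub>?S\<^esub> p \<in> (\<lambda>f. ?I +>\<^bsub>?S\<^esub> f) ` (PIdl\<^bsub>?S\<^esub> g)) \<longleftrightarrow> (\<exists>w. p = skew_mult \<sigma> w g)" for p
  proof
    assume "?I +>\<^bsub>?S\<^esub> p \<in> (\<lambda>f. ?I +>\<^bsub>?S\<^esub> f) ` (PIdl\<^bsub>?S\<^esub> g)"
    then obtain v where v: "?I +>\<^bsub>?S\<^esub> p = ?I +>\<^bsub>?S\<^esub> (skew_mult \<sigma> v g)"
      unfolding gl by auto
    have "skew_mult \<sigma> 0 (skew_mult \<sigma> q g) + p = p"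
      by (simp add: skew_mult_def)
    then have "p \<in> ?I +>\<^bsub>?S\<^esub> p"
      unfolding coset by force
    then obtain u where "p = skew_mult \<sigma> u (skew_mult \<sigma> q g) + skew_mult \<sigma> v g"
      unfolding v unfolding coset by auto
    then have "p = skew_mult \<sigma> (skew_mult \<sigma> u q + v) g"
      by (simp add: skew_mult_add_left[OF hom] skew_mult_assoc[OF hom])
    then show "\<exists>w. p = skew_mult \<sigma> w g"
      by blast
  next
    assume "\<exists>w. p = skew_mult \<sigma> w g"
    then show "?I +>\<^bsub>?S\<^esub> p \<in> (\<lambda>f. ?I +>\<^bsub>?S\<^esub> f) ` (PIdl\<^bsub>?S\<^esub> g)"
      unfolding gl by auto
  qed
  then show ?thesis
    by (simp add: constacyclic_code_def Let_def vec_poly_def)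
qed

text \<open>
  Encoding a message with the generator matrix is right multiplication of its polynomial by \<open>g\<close>. The
  degree bounds guarantee that the product has no coefficients beyond the code length.
\<close>

lemma encode_constacyclic_generator_matrix:
  fixes \<sigma> :: "'a::comm_ring_1 \<Rightarrow> 'a"
  assumes hom: "comm_ring_hom \<sigma>" and g: "degree g \<le> n - k" and k: "k \<le> n" and v: "v \<in> carrier_vec k"
  shows "vec_poly n ((constacyclic_generator_matrix \<sigma> n k g)\<^sup>T *\<^sub>v v) =
    skew_mult \<sigma> (vec_poly k v) g"
proof (rule poly_eqI)
  fix j
  let ?G = "constacyclic_generator_matrix \<sigma> n k g"
  have mult: "coeff (skew_mult \<sigma> (vec_poly k v) g) j =
      (\<Sum>i<k. if i \<le> j then v $ i * (\<sigma> ^^ i) (coeff g (j - i)) else 0)"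
    by (subst coeff_skew_mult_lessThan[OF hom, of k]) (auto simp: coeff_vec_poly intro!: sum.cong)
  show "coeff (vec_poly n (?G\<^sup>T *\<^sub>v v)) j = coeff (skew_mult \<sigma> (vec_poly k v) g) j"
  proof (cases "j < n")
    case True
    then have "(?G\<^sup>T *\<^sub>v v) $ j =
        (\<Sum>i\<in>{0..<k}. (if i \<le> j then (\<sigma> ^^ i) (coeff g (j - i)) else 0) * v $ i)"
      using v by (simp add: constacyclic_generator_matrix_def scalar_prod_def)
    also have "\<dots> = coeff (skew_mult \<sigma> (vec_poly k v) g) j"
      unfolding mult by (rule sum.cong) (auto simp: mult.commute)
    finally show ?thesis
      using True by (simp add: coeff_vec_poly)
  next
    case False
    then have "coeff g (j - i) = 0" if "i < k" for i
      using that g k by (intro coeff_eq_0) auto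
    then have "coeff (skew_mult \<sigma> (vec_poly k v) g) j = 0"
      unfolding mult by (intro sum.neutral) (auto simp: funpow_hom_simps[OF hom])
    then show ?thesis
      using False by (simp add: coeff_vec_poly)
  qed
qed

text \<open>
  A multiple \<open>p g\<close> of degree below \<open>n\<close> has \<open>deg p < k\<close> as \<open>g\<close> is monic of degree \<open>n - k\<close>, so \<open>p\<close> is the
  polynomial of a message of length \<open>k\<close>.
\<close>

lemma constacyclic_code_eq_row_span:
  fixes \<sigma> :: "'a::comm_ring_1 \<Rightarrow> 'a"
  assumes hom: "comm_ring_hom \<sigma>" and q: "skew_mult \<sigma> q g = monom 1 n - [:a:]"
    and g: "lead_coeff g = 1" "degree g = n - k" and k: "k \<le> n"
  shows "constacyclic_code \<sigma> n a g = row_span (constacyclic_generator_matrix \<sigma> n k g)"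
proof -
  let ?G = "constacyclic_generator_matrix \<sigma> n k g"
  have G: "?G \<in> carrier_mat k n"
    by (simp add: constacyclic_generator_matrix_def)
  have vec_poly_inj: "x = y" if "vec_poly n x = vec_poly n y" "x \<in> carrier_vec n" "y \<in> carrier_vec n"
    for x y :: "'a vec"
  proof
    fix j assume "j < dim_vec y"
    then show "x $ j = y $ j"
      using arg_cong[OF that(1), of "\<lambda>p. coeff p j"] that(3) by (simp add: coeff_vec_poly)
  qed (use that in simp)
  show ?thesis
  proof
    show "row_span ?G \<subseteq> constacyclic_code \<sigma> n a g"
    proof
      fix d assume "d \<in> row_span ?G"
      then obtain v where "v \<in> carrier_vec k" "d = ?G\<^sup>T *\<^sub>v v"
        using G by (auto simp: row_span_def)
      then show "d \<in> constacyclic_code \<sigma> n a g"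
        using encode_constacyclic_generator_matrix[OF hom _ k, of g v] G g
        by (auto simp: mem_constacyclic_code_iff[OF hom q])
    qed
    show "constacyclic_code \<sigma> n a g \<subseteq> row_span ?G"
    proof
      fix d assume "d \<in> constacyclic_code \<sigma> n a g"
      then obtain p where d: "d \<in> carrier_vec n" and p: "vec_poly n d = skew_mult \<sigma> p g"
        by (auto simp: mem_constacyclic_code_iff[OF hom q])
      have p_high: "coeff p i = 0" if "k \<le> i" for i
      proof (rule ccontr)
        assume "coeff p i \<noteq> 0"
        then have "p \<noteq> 0" "k \<le> degree p"
          using that le_degree[of p i] by auto
        then have deg: "n \<le> degree (skew_mult \<sigma> p g)"
          using degree_skew_mult_monic[OF hom g(1)] g(2) by simp
        then have "lead_coeff (skew_mult \<sigma> p g) = 0"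
          using coeff_vec_poly[of n d] p by (metis leD)
        moreover have "lead_coeff (skew_mult \<sigma> p g) = lead_coeff p"
          using coeff_skew_mult_top[OF hom order_refl order_refl, of p g] g(1)
            degree_skew_mult_monic[OF hom g(1) \<open>p \<noteq> 0\<close>]
          by (simp add: funpow_hom_simps[OF hom])
        ultimately show False
          using \<open>p \<noteq> 0\<close> by simp
      qed
      define v where "v = vec k (coeff p)"
      have v: "v \<in> carrier_vec k" "vec_poly k v = p"
        using p_high by (auto simp: v_def coeff_vec_poly intro!: poly_eqI)
      then have "vec_poly n d = vec_poly n (?G\<^sup>T *\<^sub>v v)"
        using encode_constacyclic_generator_matrix[OF hom _ k v(1), of g] g p by simp
      then have "d = ?G\<^sup>T *\<^sub>v v"
        using vec_poly_inj d G v by auto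
      then show "d \<in> row_span ?G"
        using G v by (auto simp: row_span_def)
    qed
  qed
qed

section \<open>The parity-check matrix\<close>

lemma det_one_of_unit_diagonal:
  fixes M :: "'a::comm_ring_1 mat"
  assumes M: "M \<in> carrier_mat r r" and diag: "\<And>i. i < r \<Longrightarrow> M $$ (i, i) = 1"
    and tri: "(\<forall>i j. i < j \<longrightarrow> j < r \<longrightarrow> M $$ (i, j) = 0) \<or> (\<forall>i j. j < i \<longrightarrow> i < r \<longrightarrow> M $$ (i, j) = 0)"
  shows "det M = 1"
proof -
  have "det M = prod_list (diag_mat M)"
    using tri det_lower_triangular[OF _ M] det_upper_triangular[OF _ M] M by auto
  also have "diag_mat M = map (\<lambda>i. 1) [0..<r]"
    using M diag by (auto simp: diag_mat_def)
  also have "prod_list \<dots> = 1"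
    by (induction r) simp_all
  finally show ?thesis .
qed

text \<open>
  The entry at \<open>(t, i)\<close> is a convolution sum: with \<open>j = i + l\<close>,
  \<open>\<Sum>\<^sub>j \<sigma>\<^sup>i(g\<^bsub>j-i\<^esub>) \<sigma>\<^sup>j(h\<^bsub>t+k-j\<^esub>) = \<sigma>\<^sup>i(\<Sum>\<^sub>l g\<^sub>l \<sigma>\<^sup>l(h\<^bsub>t+k-i-l\<^esub>))\<close>, which is \<open>\<sigma>\<^sup>i\<close> of the coefficient of
  \<open>g h\<close> at \<open>t + k - i\<close>.
\<close>

lemma constacyclic_parity_mult_generator:
  fixes \<sigma> :: "'a::comm_ring_1 \<Rightarrow> 'a"
  assumes hom: "comm_ring_hom \<sigma>" and h: "degree h \<le> k"
    and gh: "\<And>m. 0 < m \<Longrightarrow> m < n \<Longrightarrow> coeff (skew_mult \<sigma> g h) m = 0"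
  shows "constacyclic_parity_matrix \<sigma> n k h * (constacyclic_generator_matrix \<sigma> n k g)\<^sup>T =
    0\<^sub>m (n - k) k"
    (is "?H * ?G\<^sup>T = _")
proof
  note [simp] = funpow_hom_simps[OF hom]
  fix t i assume "t < dim_row (0\<^sub>m (n - k) k :: 'a mat)" "i < dim_col (0\<^sub>m (n - k) k :: 'a mat)"
  then have t: "t < n - k" and i: "i < k" by simp_all
  let ?s = "t + k - i"
  have s: "t + k = i + ?s"
    using i by simp
  have "(?H * ?G\<^sup>T) $$ (t, i) = (\<Sum>j\<in>{0..<n}. ?H $$ (t, j) * ?G $$ (i, j))"
    using t i
    by (simp add: constacyclic_parity_matrix_def constacyclic_generator_matrix_def scalar_prod_def)
  also have "\<dots> = (\<Sum>j\<in>{i..t + k}. (\<sigma> ^^ i) (coeff g (j - i)) * (\<sigma> ^^ j) (coeff h (t + k - j)))"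
  proof (rule sum.mono_neutral_cong_right)
    show "{i..t + k} \<subseteq> {0..<n}"
      using t by auto
  next
    fix j assume "j \<in> {i..t + k}"
    \<comment> \<open>so the zeros in front of row \<open>t\<close> agree with the general formula for its entries\<close>
    moreover have "coeff h (t + k - j) = 0" if "j < t"
      using that h by (intro coeff_eq_0) auto
    ultimately show "?H $$ (t, j) * ?G $$ (i, j) =
        (\<sigma> ^^ i) (coeff g (j - i)) * (\<sigma> ^^ j) (coeff h (t + k - j))"
      using t i by (auto simp: constacyclic_parity_matrix_def constacyclic_generator_matrix_def)
  qed (use t i in \<open>auto simp: constacyclic_parity_matrix_def constacyclic_generator_matrix_def\<close>)
  also have "\<dots> = (\<Sum>l\<in>{0..?s}. (\<sigma> ^^ i) (coeff g l) * (\<sigma> ^^ (i + l)) (coeff h (?s - l)))"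
    using sum.shift_bounds_cl_nat_ivl[of "\<lambda>j. (\<sigma> ^^ i) (coeff g (j - i)) * (\<sigma> ^^ j) (coeff h (t + k - j))" 0 i ?s]
      s by (simp add: add.commute)
  also have "\<dots> = (\<sigma> ^^ i) (coeff (skew_mult \<sigma> g h) ?s)"
    by (simp add: coeff_skew_mult[OF hom] funpow_add atLeast0AtMost)
  also have "\<dots> = 0"
    using gh[of ?s] t i by simp
  finally show "(?H * ?G\<^sup>T) $$ (t, i) = 0\<^sub>m (n - k) k $$ (t, i)"
    using t i by simp
qed (simp_all add: constacyclic_parity_matrix_def constacyclic_generator_matrix_def)

text \<open>
  The last \<open>k\<close> columns of the generator matrix are lower unitriangular because \<open>g\<close> is monic of degree
  \<open>n - k\<close>, and the first \<open>n - k\<close> columns of the parity matrix are upper unitriangular because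
  \<open>g h = X\<^sup>n - b\<close> makes \<open>h\<close> monic of degree \<open>k\<close> whenever \<open>n > 0\<close>.
\<close>

lemma parity_check_matrix_constacyclic:
  fixes \<sigma> :: "'a::comm_ring_1 \<Rightarrow> 'a"
  assumes hom: "comm_ring_hom \<sigma>" and inj: "inj \<sigma>"
    and g: "lead_coeff g = 1" "degree g = n - k" and k: "k \<le> n"
    and q: "skew_mult \<sigma> q g = monom 1 n - [:a:]"
    and h: "degree h \<le> k" and gh: "skew_mult \<sigma> g h = monom 1 n - [:b:]"
  shows "vec_module.parity_check_matrix n k (constacyclic_parity_matrix \<sigma> n k h)
    (constacyclic_code \<sigma> n a g)"
proof -
  let ?G = "constacyclic_generator_matrix \<sigma> n k g"
  let ?H = "constacyclic_parity_matrix \<sigma> n k h"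
  note [simp] = funpow_hom_simps[OF hom]
  have G: "?G \<in> carrier_mat k n" and H: "?H \<in> carrier_mat (n - k) n"
    by (simp_all add: constacyclic_generator_matrix_def constacyclic_parity_matrix_def)
  \<comment> \<open>for \<open>n = k = 0\<close> the constant \<open>h = 1 - b\<close> need not be \<open>1\<close>, but then the matrix has no rows\<close>
  have h_k: "coeff h k = 1" if "k < n"
  proof -
    have "(\<sigma> ^^ (n - k)) (coeff h k) = coeff (skew_mult \<sigma> g h) n"
      using coeff_skew_mult_top[OF hom _ h, of g "n - k"] g k by simp
    also have "\<dots> = (\<sigma> ^^ (n - k)) 1"
      using that by (simp add: gh coeff_pCons split: nat.splits)
    finally show ?thesis
      using inj_fn[OF inj, of "n - k"] by (metis injD)
  qed
  have "det (column_block ?G (n - k)) = 1"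
  proof (rule det_one_of_unit_diagonal[OF column_block_carrier[OF G]])
    show "column_block ?G (n - k) $$ (i, i) = 1" if "i < k" for i
      using that g k by (simp add: column_block_def constacyclic_generator_matrix_def)
    have "column_block ?G (n - k) $$ (i, j) = 0" if "i < j" "j < k" for i j
      using that g k by (simp add: column_block_def constacyclic_generator_matrix_def coeff_eq_0)
    then show "(\<forall>i j. i < j \<longrightarrow> j < k \<longrightarrow> column_block ?G (n - k) $$ (i, j) = 0) \<or>
        (\<forall>i j. j < i \<longrightarrow> i < k \<longrightarrow> column_block ?G (n - k) $$ (i, j) = 0)"
      by blast
  qed
  moreover have "det (column_block ?H 0) = 1"
    by (rule det_one_of_unit_diagonal[OF column_block_carrier[OF H]])
      (auto simp: column_block_def constacyclic_parity_matrix_def h_k)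
  moreover have "?H * ?G\<^sup>T = 0\<^sub>m (n - k) k"
    by (rule constacyclic_parity_mult_generator[OF hom h])
      (simp add: gh coeff_pCons split: nat.splits)
  ultimately show ?thesis
    unfolding constacyclic_code_eq_row_span[OF hom q g k]
    by (intro vec_module.parity_check_matrix_row_span[OF k G _ H]) simp_all
qed

theorem corollary6p4:
  fixes \<sigma> :: "'a::{finite, comm_ring_1} \<Rightarrow> 'a"
    and a :: 'a and n k :: nat and g :: "'a poly"
  assumes "comm_ring_isom \<sigma>"
    and "a dvd 1"
    and "k \<le> n"
    and "lead_coeff g = 1" and "degree g = n - k" and "coeff g 0 dvd 1"
    and "skew_right_divisor \<sigma> g (monom 1 n - [:a:])"
  shows "(\<exists>h. degree h \<le> k \<and>
              g \<otimes>\<^bsub>skew_poly_ring \<sigma>\<^esub> h = monom 1 n - [:(inv_into UNIV \<sigma> ^^ k) a:]) \<and>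
         (\<forall>h. degree h \<le> k \<and>
              g \<otimes>\<^bsub>skew_poly_ring \<sigma>\<^esub> h = monom 1 n - [:(inv_into UNIV \<sigma> ^^ k) a:] \<longrightarrow>
              vec_module.parity_check_matrix n k (constacyclic_parity_matrix \<sigma> n k h)
                (constacyclic_code \<sigma> n a g))"
proof -
  interpret comm_ring_isom \<sigma> by (rule assms(1))
  have hom: "comm_ring_hom \<sigma>" ..
  have mult: "p \<otimes>\<^bsub>skew_poly_ring \<sigma>\<^esub> r = skew_mult \<sigma> p r" for p r
    by (simp add: skew_poly_ring_def)
  have "\<exists>q. monom 1 n - [:a:] = skew_mult \<sigma> q g"
    using assms(7) unfolding skew_right_divisor_def mult .
  then obtain q where q: "skew_mult \<sigma> q g = monom 1 n - [:a:]"
    by metis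
  show ?thesis
    unfolding mult
  proof (intro conjI allI impI)
    show "\<exists>h. degree h \<le> k \<and> skew_mult \<sigma> g h = monom 1 n - [:(inv_into UNIV \<sigma> ^^ k) a:]"
      by (rule check_polynomial_exists[OF assms(1,4,5,3) q])
    fix h
    assume "degree h \<le> k \<and> skew_mult \<sigma> g h = monom 1 n - [:(inv_into UNIV \<sigma> ^^ k) a:]"
    then show "vec_module.parity_check_matrix n k (constacyclic_parity_matrix \<sigma> n k h)
        (constacyclic_code \<sigma> n a g)"
      using parity_check_matrix_constacyclic[OF hom bij_is_inj[OF bij] assms(4,5,3) q] by metis
  qed
qed

end
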